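(* Let $n\ge 2$ be an integer and let $$\Sigma'_{\mp}=\bigcup_{t\in[0,1]}\left\{x\in\mathbb{C} : 1+x\,t^{\frac{n-1}{n}}(1-t)^{\frac1n}e^{\mp\frac{\pi i}{n}}=0\right\}$$ (upper signs defining $\Sigma'_-$, lower signs defining $\Sigma'_+$). For every $x\in\mathbb{C}\setminus(\Sigma'_-\cup\Sigma'_+)$ the integral below converges, and the principal root $z(x)$ of the trinomial equation $z^n+xz^{n-1}-1=0$ is given by $$z(x)=\left\{1+\frac{1}{4\pi i\, n}\int_0^1 t^{\frac{1}{2n}-1}(1-t)^{-\frac{1}{2n}-1}\left[e^{\frac{\pi i}{2n}}\log\left(1+x\,t^{\frac{n-1}{n}}(1-t)^{\frac1n}e^{-\frac{\pi i}{n}}\right)-e^{-\frac{\pi i}{2n}}\log\left(1+x\,t^{\frac{n-1}{n}}(1-t)^{\frac1n}e^{\frac{\pi i}{n}}\right)\right]\mathrm{d}t\right\}^2 .$$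
   Context: The principal root (branch) of $z^n+xz^{n-1}-1=0$ is the solution $z=z(x)$ that is holomorphic in $x$ near $x=0$ with $z(0)=1$, and, on the connected domain $\mathbb{C}\setminus(\Sigma'_-\cup\Sigma'_+)$ (which contains $0$), its holomorphic continuation; in particular it satisfies $z(x)^n+x\,z(x)^{n-1}-1=0$ there. Here $\log$ is the principal branch of the logarithm (holomorphic off $(-\infty,0]$, with $\log 1=0$), and fractional powers of $t,1-t\in[0,1]$ are the nonnegative real ones. *)

theory Defs
  imports "HOL-Complex_Analysis.Complex_Analysis"
begin

definition trin_weight :: "nat \<Rightarrow> real \<Rightarrow> real" where
  "trin_weight n t = t powr ((real n - 1) / real n) * (1 - t) powr (1 / real n)"

definition Sigma_minus :: "nat \<Rightarrow> complex set" where
  "Sigma_minus n = (\<Union>t\<in>{0..1}. {x. 1 + x * of_real (trin_weight n t) * exp (- (of_real pi * \<i> / of_nat n)) = 0})"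

definition Sigma_plus :: "nat \<Rightarrow> complex set" where
  "Sigma_plus n = (\<Union>t\<in>{0..1}. {x. 1 + x * of_real (trin_weight n t) * exp (of_real pi * \<i> / of_nat n) = 0})"

definition trin_domain :: "nat \<Rightarrow> complex set" where
  "trin_domain n = UNIV - (Sigma_minus n \<union> Sigma_plus n)"

text \<open>The equation is imposed only near 0. The domain is connected and contains 0, so
  holomorphy on all of it makes \<open>z\<close> the continuation of the germ at 0; the values of
  \<open>z\<close> outside the domain are unconstrained.\<close>

definition principal_root :: "nat \<Rightarrow> (complex \<Rightarrow> complex) \<Rightarrow> bool" where
  "principal_root n z \<longleftrightarrow>
     z holomorphic_on trin_domain n \<and> z 0 = 1 \<and>
     (\<forall>\<^sub>F x in nhds 0. z x ^ n + x * z x ^ (n - 1) - 1 = 0)"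

text \<open>On the domain, both arguments of \<open>Ln\<close> below avoid the nonpositive reals.\<close>

definition trin_integrand :: "nat \<Rightarrow> complex \<Rightarrow> real \<Rightarrow> complex" where
  "trin_integrand n x t =
     of_real (t powr (1 / (2 * real n) - 1) * (1 - t) powr (- (1 / (2 * real n)) - 1)) *
     (exp (of_real pi * \<i> / (2 * of_nat n)) *
        Ln (1 + x * of_real (trin_weight n t) * exp (- (of_real pi * \<i> / of_nat n)))
      - exp (- (of_real pi * \<i> / (2 * of_nat n))) *
        Ln (1 + x * of_real (trin_weight n t) * exp (of_real pi * \<i> / of_nat n)))"

end

theory Submission imports Defs begin

text \<open>The exceptional set consists of two rays pointing away from the origin, so the domain is star-shaped
  about 0, and dominated differentiation makes the bracketed expression \<open>F(x)\<close> holomorphic on it.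
  Near 0 its logarithms can be expanded and integrated term by term. The moments are Beta values, and
  with \<open>a = (k - 1/2)/n\<close> the reflection formula turns \<open>sin (\<pi> a) B(k - a, a)\<close> into
  \<open>\<pi>\<close> times the binomial coefficient of \<open>k - 1 - a\<close> over \<open>k - 1\<close>. Up to an elementary factor this is
  the coefficient that Lagrange inversion gives for the square root of the root branch with value 1
  at 0. Hence \<open>F\<^sup>2\<close> is that branch near 0, and the identity theorem extends the
  equation and the uniqueness to the whole domain.\<close>

section \<open>Integrals of logarithms depending on a parameter\<close>

text \<open>Dominated convergence for the difference quotients differentiates under the integral.
  The dominating function may depend on the point, since the bounds on the logarithms degenerate
  towards the boundary of the domain.\<close>

lemma holomorphic_on_parameter_integral:
  fixes f f' :: "complex \<Rightarrow> 'a \<Rightarrow> complex"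
  assumes S: "open S"
    and int: "\<And>x. x \<in> S \<Longrightarrow> integrable M (f x)"
    and der: "\<And>x t. x \<in> S \<Longrightarrow> t \<in> space M \<Longrightarrow> ((\<lambda>y. f y t) has_field_derivative f' x t) (at x)"
    and dom: "\<And>x. x \<in> S \<Longrightarrow> \<exists>d>0. \<exists>g. integrable M g \<and>
                (\<forall>y\<in>ball x d. \<forall>t\<in>space M. norm (f' y t) \<le> g t)"
  shows "(\<lambda>x. \<integral>t. f x t \<partial>M) holomorphic_on S"
proof -
  have "(\<lambda>x. \<integral>t. f x t \<partial>M) field_differentiable at x" if x: "x \<in> S" for x
  proof -
    obtain d1 g where d1: "d1 > 0" and g: "integrable M g"
      and gb: "\<And>y t. y \<in> ball x d1 \<Longrightarrow> t \<in> space M \<Longrightarrow> norm (f' y t) \<le> g t"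
      using dom[OF x] by metis
    obtain d2 where d2: "d2 > 0" "ball x d2 \<subseteq> S" using S x open_contains_ball by metis
    define d where "d = min d1 d2"
    have d: "d > 0" and dS: "ball x d \<subseteq> S" and dd: "ball x d \<subseteq> ball x d1"
      using d1 d2 by (auto simp: d_def)
    \<comment> \<open>A ball is convex, so the bound on \<open>f'\<close> becomes a Lipschitz bound,
      and the same \<open>g\<close> dominates all difference quotients.\<close>
    have lip: "norm (f y t - f x t) \<le> g t * norm (y - x)" if "y \<in> ball x d" "t \<in> space M" for y t
    proof (rule field_differentiable_bound[of "ball x d" "\<lambda>y. f y t" "\<lambda>y. f' y t"])
      show "((\<lambda>y. f y t) has_field_derivative f' z t) (at z within ball x d)" if "z \<in> ball x d" for z
        using der[of z t] that dS \<open>t \<in> space M\<close> by (meson has_field_derivative_at_within subsetD)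
      show "norm (f' z t) \<le> g t" if "z \<in> ball x d" for z
        using gb[of z t] that dd \<open>t \<in> space M\<close> by blast
    qed (use that d in auto)
    have "((\<lambda>y. ((\<integral>t. f y t \<partial>M) - (\<integral>t. f x t \<partial>M)) / (y - x)) \<longlongrightarrow> (\<integral>t. f' x t \<partial>M)) (at x)"
      unfolding tendsto_at_iff_sequentially
    proof (intro allI impI)
      fix X :: "nat \<Rightarrow> complex"
      assume X: "\<forall>i. X i \<in> UNIV - {x}" "X \<longlonglongrightarrow> x"
      obtain N where N: "\<And>i. i \<ge> N \<Longrightarrow> X i \<in> ball x d"
        using X(2) d unfolding lim_sequentially by (metis dist_commute mem_ball)
      \<comment> \<open>Dropping the first \<open>N\<close> terms keeps the sequence inside the ball
        where \<open>lip\<close> applies.\<close>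
      define Y where "Y = (\<lambda>i. X (i + N))"
      have Yb: "Y i \<in> ball x d" and Yn: "Y i \<noteq> x" for i using N X(1) by (auto simp: Y_def)
      have Yl: "Y \<longlonglongrightarrow> x" unfolding Y_def by (rule LIMSEQ_ignore_initial_segment) (rule X(2))
      have intY: "integrable M (f (Y i))" for i using int Yb dS by blast
      have lim: "(\<lambda>i. (f (Y i) t - f x t) / (Y i - x)) \<longlonglongrightarrow> f' x t" if "t \<in> space M" for t
      proof -
        have "((\<lambda>y. (f y t - f x t) / (y - x)) \<longlongrightarrow> f' x t) (at x)"
          using der[OF x that] by (simp add: has_field_derivative_iff)
        then show ?thesis using Yl Yn unfolding tendsto_at_iff_sequentially comp_def by auto
      qed
      have m: "(\<lambda>t. (f (Y i) t - f x t) / (Y i - x)) \<in> borel_measurable M" for i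
        using intY[of i] int[OF x] by (intro borel_measurable_divide borel_measurable_diff) auto
      have "(\<lambda>i. \<integral>t. (f (Y i) t - f x t) / (Y i - x) \<partial>M) \<longlonglongrightarrow> (\<integral>t. f' x t \<partial>M)"
      proof (rule integral_dominated_convergence[where w=g])
        \<comment> \<open>Measurability of \<open>f' x\<close> comes from its being a pointwise
          limit of measurable quotients.\<close>
        show "f' x \<in> borel_measurable M" using m lim by (rule borel_measurable_LIMSEQ_metric)
        show "AE t in M. norm ((f (Y i) t - f x t) / (Y i - x)) \<le> g t" for i
          using lip[OF Yb[of i]] Yn[of i] by (intro AE_I2) (auto simp: norm_divide divide_le_eq)
      qed (use g m lim in auto)
      also have "(\<lambda>i. \<integral>t. (f (Y i) t - f x t) / (Y i - x) \<partial>M) =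
          (\<lambda>i. ((\<integral>t. f (Y i) t \<partial>M) - (\<integral>t. f x t \<partial>M)) / (Y i - x))"
        by (simp add: Bochner_Integration.integral_diff[OF intY int[OF x]])
      finally show "((\<lambda>y. ((\<integral>t. f y t \<partial>M) - (\<integral>t. f x t \<partial>M)) / (y - x)) \<circ> X)
          \<longlonglongrightarrow> (\<integral>t. f' x t \<partial>M)"
        unfolding Y_def comp_def by (rule LIMSEQ_offset[of _ N])
    qed
    then show ?thesis unfolding field_differentiable_def has_field_derivative_iff by blast
  qed
  then show ?thesis using field_differentiable_at_within holomorphic_on_def by blast
qed

text \<open>Mean value estimate along the segment from 0 to \<open>y\<close>, with derivative
  \<open>1 / (1 + z)\<close>. The factor \<open>norm y\<close> is what later compensates the
  singularity of the kernel.\<close>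

lemma norm_Ln_one_plus_le:
  assumes "\<And>s. s \<in> {0..1} \<Longrightarrow> 1 + of_real s * y \<notin> \<real>\<^sub>\<le>\<^sub>0"
    and "\<And>s. s \<in> {0..1} \<Longrightarrow> \<delta> \<le> norm (1 + of_real s * y)" and "\<delta> > 0"
  shows "norm (Ln (1 + y)) \<le> norm y / \<delta>"
proof -
  have seg: "z \<in> closed_segment 0 y \<Longrightarrow> \<exists>s\<in>{0..1}. z = of_real s * y" for z
    by (auto simp: closed_segment_def scaleR_conv_of_real)
  have "norm (Ln (1 + y) - Ln (1 + 0)) \<le> 1 / \<delta> * norm (y - 0)"
  proof (rule field_differentiable_bound[of "closed_segment 0 y" "\<lambda>z. Ln (1 + z)" "\<lambda>z. 1 / (1 + z)"])
    show "((\<lambda>z. Ln (1 + z)) has_field_derivative 1 / (1 + z)) (at z within closed_segment 0 y)"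
      if "z \<in> closed_segment 0 y" for z
    proof -
      have "1 + z \<notin> \<real>\<^sub>\<le>\<^sub>0" using seg[OF that] assms(1) by auto
      then show ?thesis by (auto intro!: derivative_eq_intros simp: field_simps)
    qed
    show "norm (1 / (1 + z)) \<le> 1 / \<delta>" if "z \<in> closed_segment 0 y" for z
      using seg[OF that] assms(2,3) by (auto simp: norm_divide intro!: divide_left_mono mult_pos_pos)
       (metis less_le_trans zero_less_norm_iff atLeastAtMost_iff)
  qed auto
  then show ?thesis by simp
qed

text \<open>An abstract version of the two halves of the integrand: \<open>k\<close> is the singular kernel,
  \<open>w\<close> the weight and \<open>e\<close> the root of unity inside the logarithm.\<close>

locale log_integral =
  fixes k w :: "real \<Rightarrow> real" and e :: complex
  assumes k_nonneg: "\<And>t. k t \<ge> 0"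
    and k_measurable [measurable]: "k \<in> borel_measurable borel"
    and w_measurable [measurable]: "w \<in> borel_measurable borel"
    and w_cont: "continuous_on {0..1} w"
    and w_0: "w 0 = 0"
    and w_range: "\<And>t. t \<in> {0..1} \<Longrightarrow> w t \<in> {0..1}"
    and kw_integrable: "set_integrable lborel {0<..<1} (\<lambda>t. k t * w t)"
    and norm_e: "norm e = 1"
begin

text \<open>Only zeros of the argument are excluded, as in \<open>Sigma_minus\<close> and
  \<open>Sigma_plus\<close>; that the whole branch cut is avoided is derived from this
  below.\<close>

definition log_domain :: "complex set" where
  "log_domain = {x. \<forall>t\<in>{0..1}. 1 + x * of_real (w t) * e \<noteq> 0}"

definition J :: "complex \<Rightarrow> complex" where
  "J x = (LBINT t:{0<..<1}. of_real (k t) * Ln (1 + x * of_real (w t) * e))"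

text \<open>Intermediate value theorem: as \<open>w\<close> starts at 0, shrinking the value
  \<open>w t\<close> amounts to moving \<open>t\<close>. Scaling of \<open>x\<close> thereby becomes
  a change of parameter.\<close>

lemma scale_w:
  assumes "t \<in> {0..1}" "s \<in> {0..1}"
  obtains t' where "t' \<in> {0..1}" "w t' = s * w t"
proof -
  have "w 0 \<le> s * w t" "s * w t \<le> w t"
    using w_range[OF assms(1)] assms(2) by (auto simp: w_0 mult_left_le_one_le)
  moreover have "continuous_on {0..t} w" using w_cont assms(1) by (auto intro: continuous_on_subset)
  ultimately obtain t' where "t' \<ge> 0" "t' \<le> t" "w t' = s * w t"
    using assms(1) IVT'[of w 0 "s * w t" t] by auto
  with that[of t'] assms(1) show ?thesis by simp
qed

section \<open>Shape of the logarithm's domain\<close>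

lemma zero_in_log_domain: "0 \<in> log_domain" by (simp add: log_domain_def)

lemma scale_in_log_domain:
  assumes "x \<in> log_domain" "s \<in> {0..1}" shows "of_real s * x \<in> log_domain"
  unfolding log_domain_def
proof (intro CollectI ballI)
  fix t :: real assume "t \<in> {0..1}"
  then obtain t' where t': "t' \<in> {0..1}" "w t' = s * w t" using scale_w assms(2) by blast
  then have "1 + x * of_real (w t') * e \<noteq> 0" using assms(1) unfolding log_domain_def by blast
  moreover have "x * of_real (w t') * e = of_real s * x * of_real (w t) * e" by (simp add: t'(2))
  ultimately show "1 + of_real s * x * of_real (w t) * e \<noteq> 0" by simp
qed

text \<open>If the argument took a value \<open>r \<le> 0\<close>, then scaling \<open>x\<close> by
  \<open>1 / (1 - r)\<close>, a factor in \<open>{0..1}\<close>, would produce the value 0, although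
  the scaled point is still in the domain.\<close>

lemma log_domain_not_nonpos_Reals:
  assumes "x \<in> log_domain" "t \<in> {0..1}"
  shows "1 + x * of_real (w t) * e \<notin> \<real>\<^sub>\<le>\<^sub>0"
proof
  assume "1 + x * of_real (w t) * e \<in> \<real>\<^sub>\<le>\<^sub>0"
  then obtain r where r: "r \<le> 0" "1 + x * of_real (w t) * e = of_real r"
    by (auto elim: nonpos_Reals_cases)
  define s where "s = 1 / (1 - r)"
  have s: "s \<in> {0..1}" using r(1) by (auto simp: s_def)
  have "x * of_real (w t) * e = of_real (r - 1)" using r(2) by (simp add: algebra_simps)
  then have "1 + of_real s * x * of_real (w t) * e = 1 + of_real s * of_real (r - 1)"
    by (metis mult.assoc)
  also have "\<dots> = of_real (1 + s * (r - 1))" by (simp only: of_real_add of_real_mult of_real_1)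
  also have "1 + s * (r - 1) = 0" using r(1) by (simp add: s_def field_simps)
  finally show False using scale_in_log_domain[OF assms(1) s] assms(2) by (auto simp: log_domain_def)
qed

text \<open>The factor \<open>s\<close> is absorbed into \<open>t\<close> by \<open>scale_w\<close>,
  so a minimum over the compact set \<open>K \<times> {0..1}\<close> suffices. With \<open>s\<close>
  present, the bound covers the whole segment used in \<open>norm_Ln_one_plus_le\<close>.\<close>

lemma log_domain_lower_bound:
  assumes "compact K" "K \<subseteq> log_domain"
  obtains \<delta> where "\<delta> > 0"
    "\<And>x t s. x \<in> K \<Longrightarrow> t \<in> {0..1} \<Longrightarrow> s \<in> {0..1} \<Longrightarrow> \<delta> \<le> norm (1 + of_real s * (x * of_real (w t) * e))"
proof (cases "K = {}")
  case True then show ?thesis using that[of 1] by auto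
next
  case False
  define h where "h = (\<lambda>p. norm (1 + fst p * of_real (w (snd p)) * e))"
  have "continuous_on (K \<times> {0..1}) (\<lambda>p. w (snd p))"
    by (rule continuous_on_compose2[OF w_cont continuous_on_snd[OF continuous_on_id]]) auto
  then have "continuous_on (K \<times> {0..1}) h" unfolding h_def by (intro continuous_intros)
  moreover have "compact (K \<times> {0..1::real})" using assms(1) by (intro compact_Times) auto
  moreover have "K \<times> {0..1::real} \<noteq> {}" using False by auto
  ultimately obtain p where p: "p \<in> K \<times> {0..1}" "\<And>q. q \<in> K \<times> {0..1} \<Longrightarrow> h p \<le> h q"
    using continuous_attains_inf by metis
  show ?thesis
  proof (rule that)
    show "h p > 0" using p(1) assms(2) by (auto simp: h_def log_domain_def)
    fix x and t s :: real assume *: "x \<in> K" "t \<in> {0..1}" "s \<in> {0..1}"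
    then obtain t' where t': "t' \<in> {0..1}" "w t' = s * w t" using scale_w by blast
    have "h p \<le> h (x, t')" using p(2) * t' by auto
    then show "h p \<le> norm (1 + of_real s * (x * of_real (w t) * e))"
      by (simp add: h_def t'(2) mult_ac)
  qed
qed

text \<open>The lower bound at the point itself serves as radius: since \<open>w \<le> 1\<close> on
  \<open>{0..1}\<close> and \<open>norm e = 1\<close>, the argument moves no further than
  \<open>x\<close> does.\<close>

lemma open_log_domain: "open log_domain"
  unfolding open_contains_ball
proof
  fix x assume x: "x \<in> log_domain"
  obtain \<delta> where \<delta>: "\<delta> > 0"
    "\<And>t. t \<in> {0..1} \<Longrightarrow> \<delta> \<le> norm (1 + of_real (1::real) * (x * of_real (w t) * e))"
  proof (rule log_domain_lower_bound[of "{x}"])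
    fix \<delta> :: real assume "\<delta> > 0" and *: "\<And>y t s. y \<in> {x} \<Longrightarrow> t \<in> {0..1} \<Longrightarrow> s \<in> {0..1} \<Longrightarrow>
      \<delta> \<le> norm (1 + of_real s * (y * of_real (w t) * e))"
    show thesis by (rule that[OF \<open>\<delta> > 0\<close>], rule *) auto
  qed (use x in auto)
  have "y \<in> log_domain" if "y \<in> ball x \<delta>" for y
    unfolding log_domain_def
  proof (intro CollectI ballI notI)
    fix t :: real assume t: "t \<in> {0..1}" and 0: "1 + y * of_real (w t) * e = 0"
    have "\<delta> \<le> norm (1 + x * of_real (w t) * e)" using \<delta>(2)[OF t] by simp
    also have "1 + x * of_real (w t) * e = (x - y) * of_real (w t) * e + (1 + y * of_real (w t) * e)"
      by (simp add: algebra_simps)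
    also have "norm \<dots> = norm (x - y) * w t" using w_range[OF t] by (simp add: 0 norm_mult norm_e)
    also have "\<dots> \<le> norm (x - y)" using w_range[OF t] by (simp add: mult_left_le)
    finally show False using that by (simp add: dist_norm)
  qed
  then show "\<exists>d>0. ball x d \<subseteq> log_domain" using \<delta>(1) by blast
qed

text \<open>Integrability is available for \<open>k * w\<close> but not for \<open>k\<close>, so the
  logarithm and its derivative in \<open>x\<close> are both bounded by a multiple of
  \<open>w\<close>, uniformly on compact sets.\<close>

lemma norm_Ln_le:
  assumes "compact K" "K \<subseteq> log_domain"
  obtains C where "\<And>x t. x \<in> K \<Longrightarrow> t \<in> {0..1} \<Longrightarrow> norm (Ln (1 + x * of_real (w t) * e)) \<le> C * w t"
    "\<And>x t. x \<in> K \<Longrightarrow> t \<in> {0..1} \<Longrightarrow> norm (of_real (w t) * e / (1 + x * of_real (w t) * e)) \<le> C * w t"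
proof -
  obtain \<delta> where \<delta>: "\<delta> > 0"
    "\<And>x t s. x \<in> K \<Longrightarrow> t \<in> {0..1} \<Longrightarrow> s \<in> {0..1} \<Longrightarrow> \<delta> \<le> norm (1 + of_real s * (x * of_real (w t) * e))"
    using log_domain_lower_bound[OF assms] by metis
  obtain B where B: "\<And>x. x \<in> K \<Longrightarrow> norm x \<le> B" "B > 0"
    using compact_imp_bounded[OF assms(1)] bounded_pos by metis
  show ?thesis
  \<comment> \<open>\<open>B + 1\<close> exceeds both \<open>B\<close>, as the first bound needs,
    and 1, as the second one needs.\<close>
  proof (rule that[of "(B + 1) / \<delta>"])
    fix x and t :: real assume *: "x \<in> K" "t \<in> {0..1}"
    note w = w_range[OF *(2)]
    have "norm (Ln (1 + x * of_real (w t) * e)) \<le> norm (x * of_real (w t) * e) / \<delta>"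
    proof (rule norm_Ln_one_plus_le)
      show "1 + of_real s * (x * of_real (w t) * e) \<notin> \<real>\<^sub>\<le>\<^sub>0" if "s \<in> {0..1}" for s
        using log_domain_not_nonpos_Reals[OF scale_in_log_domain[OF _ that] *(2)] *(1) assms(2)
        by (simp add: mult.assoc subset_iff)
    qed (use \<delta> * in auto)
    also have "\<dots> = norm x * w t / \<delta>" using w by (simp add: norm_mult norm_e)
    also have "\<dots> \<le> (B + 1) * w t / \<delta>"
      using B(1)[OF *(1)] w \<delta>(1) by (intro divide_right_mono mult_right_mono) auto
    finally show "norm (Ln (1 + x * of_real (w t) * e)) \<le> (B + 1) / \<delta> * w t" by simp
    have "norm (of_real (w t) * e / (1 + x * of_real (w t) * e)) = w t / norm (1 + x * of_real (w t) * e)"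
      using w by (simp add: norm_divide norm_mult norm_e)
    also have "\<dots> \<le> w t / \<delta>"
      using \<delta>(2)[OF *, of 1] \<delta>(1) w by (intro divide_left_mono mult_pos_pos) auto
    also have "\<dots> \<le> (B + 1) / \<delta> * w t"
      using \<delta>(1) w B(2) by (auto simp: field_simps)
    finally show "norm (of_real (w t) * e / (1 + x * of_real (w t) * e)) \<le> (B + 1) / \<delta> * w t" .
  qed
qed

section \<open>Integrability and holomorphy of the logarithmic integral\<close>

lemma Ln_set_integrable:
  assumes x: "x \<in> log_domain"
  shows "set_integrable lborel {0<..<1} (\<lambda>t. of_real (k t) * Ln (1 + x * of_real (w t) * e))"
proof -
  obtain C where C: "\<And>t. t \<in> {0..1} \<Longrightarrow> norm (Ln (1 + x * of_real (w t) * e)) \<le> C * w t"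
    by (rule norm_Ln_le[of "{x}"]) (use x in auto)
  have "continuous_on {0<..<1} w" using w_cont by (rule continuous_on_subset) auto
  then have "continuous_on {0<..<1} (\<lambda>t. Ln (1 + x * of_real (w t) * e))"
    using log_domain_not_nonpos_Reals[OF x] by (intro continuous_intros) auto
  then have m: "set_borel_measurable lborel {0<..<1} (\<lambda>t. Ln (1 + x * of_real (w t) * e))"
    by (simp add: set_borel_measurable_def borel_measurable_continuous_on_indicator)
  have "set_borel_measurable lborel {0<..<1} (\<lambda>t. of_real (k t) * Ln (1 + x * of_real (w t) * e))"
  proof -
    have "(\<lambda>t. of_real (k t) * (indicator {0<..<1} t *\<^sub>R Ln (1 + x * of_real (w t) * e))) \<in> borel_measurable lborel"
      using m unfolding set_borel_measurable_def by measurable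
    then show ?thesis unfolding set_borel_measurable_def by (simp add: mult_ac)
  qed
  then show ?thesis
  proof (rule set_integrable_bound[rotated])
    show "set_integrable lborel {0<..<1} (\<lambda>t. C * (k t * w t))"
      using kw_integrable by simp
    show "AE t in lborel. t \<in> {0<..<1} \<longrightarrow>
        norm (of_real (k t) * Ln (1 + x * of_real (w t) * e)) \<le> norm (C * (k t * w t))"
    proof (intro AE_I2 impI)
      fix t :: real assume t: "t \<in> {0<..<1}"
      have "norm (of_real (k t) * Ln (1 + x * of_real (w t) * e)) \<le> k t * (C * w t)"
        using C[of t] t k_nonneg[of t] by (auto simp: norm_mult intro!: mult_left_mono)
      also have "\<dots> \<le> norm (C * (k t * w t))" by (simp add: mult_ac)
      finally show "norm (of_real (k t) * Ln (1 + x * of_real (w t) * e)) \<le> norm (C * (k t * w t))" .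
    qed
  qed
qed

lemma J_holomorphic: "J holomorphic_on log_domain"
proof -
  \<comment> \<open>With the indicator inside the integrand, the hypotheses on derivative and
    domination can be checked at every real \<open>t\<close>; off the interval both functions are
    0.\<close>
  let ?I = "\<lambda>t. indicator {0<..<1::real} t :: real"
  let ?f = "\<lambda>x t. ?I t *\<^sub>R (of_real (k t) * Ln (1 + x * of_real (w t) * e))"
  let ?f' = "\<lambda>x t. ?I t *\<^sub>R (of_real (k t) * (of_real (w t) * e / (1 + x * of_real (w t) * e)))"
  have "(\<lambda>x. \<integral>t. ?f x t \<partial>lborel) holomorphic_on log_domain"
  proof (rule holomorphic_on_parameter_integral[where f' = ?f'])
    show "integrable lborel (?f x)" if "x \<in> log_domain" for x
      using Ln_set_integrable[OF that] unfolding set_integrable_def .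
    show "((\<lambda>y. ?f y t) has_field_derivative ?f' x t) (at x)" if x: "x \<in> log_domain" for x t
    proof (cases "t \<in> {0<..<1}")
      case True
      then have "1 + x * of_real (w t) * e \<notin> \<real>\<^sub>\<le>\<^sub>0" using log_domain_not_nonpos_Reals[OF x] by auto
      then have "((\<lambda>y. of_real (k t) * Ln (1 + y * of_real (w t) * e)) has_field_derivative
         of_real (k t) * (of_real (w t) * e / (1 + x * of_real (w t) * e))) (at x)"
        by (auto intro!: derivative_eq_intros simp: field_simps)
      then show ?thesis using True by simp
    qed auto
    show "\<exists>d>0. \<exists>g. integrable lborel g \<and> (\<forall>y\<in>ball x d. \<forall>t\<in>space lborel. norm (?f' y t) \<le> g t)"
      if x: "x \<in> log_domain" for x
    proof -
      \<comment> \<open>A compact ball yields one constant \<open>C\<close>, hence one dominating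
        function, for all nearby points.\<close>
      obtain d where d: "d > 0" "cball x d \<subseteq> log_domain" using open_log_domain x open_contains_cball by metis
      obtain C where C: "\<And>y t. y \<in> cball x d \<Longrightarrow> t \<in> {0..1} \<Longrightarrow>
           norm (of_real (w t) * e / (1 + y * of_real (w t) * e)) \<le> C * w t"
        by (rule norm_Ln_le[OF compact_cball d(2)]) auto
      have "norm (?f' y t) \<le> ?I t *\<^sub>R (C * (k t * w t))" if "y \<in> ball x d" for y t
      proof (cases "t \<in> {0<..<1}")
        case True
        have "norm (of_real (k t) * (of_real (w t) * e / (1 + y * of_real (w t) * e))) \<le> k t * (C * w t)"
          unfolding norm_mult[of "of_real (k t)"]
          using C[of y t] that True k_nonneg[of t] by (intro mult_mono) auto
        then show ?thesis using True by (simp add: mult_ac)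
      qed auto
      moreover have "integrable lborel (\<lambda>t. ?I t *\<^sub>R (C * (k t * w t)))"
        using kw_integrable unfolding set_integrable_def[symmetric] by simp
      ultimately show ?thesis using d(1) by blast
    qed
  qed (rule open_log_domain)
  then show ?thesis by (simp add: J_def[abs_def] set_lebesgue_integral_def)
qed

section \<open>Power series of \<open>J\<close> at the origin\<close>

lemma J_0: "J 0 = 0" by (simp add: J_def)

lemma kw_power_integrable: "set_integrable lborel {0<..<1} (\<lambda>t. k t * w t ^ Suc j)"
proof (rule set_integrable_bound[OF kw_integrable])
  show "set_borel_measurable lborel {0<..<1} (\<lambda>t. k t * w t ^ Suc j)"
    unfolding set_borel_measurable_def by measurable
  show "AE t in lborel. t \<in> {0<..<1} \<longrightarrow> norm (k t * w t ^ Suc j) \<le> norm (k t * w t)"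
  proof (intro AE_I2 impI)
    fix t :: real assume t: "t \<in> {0<..<1}"
    then have "w t ^ Suc j \<le> w t" using w_range[of t] power_decreasing[of 1 "Suc j" "w t"] by auto
    then show "norm (k t * w t ^ Suc j) \<le> norm (k t * w t)"
      using k_nonneg[of t] w_range[of t] t by (auto simp: abs_mult intro!: mult_left_mono)
  qed
qed

text \<open>As \<open>w \<le> 1\<close>, the logarithmic series converges for every
  \<open>t\<close>. Its terms are dominated by \<open>k * w\<close> times a geometric sequence,
  which permits termwise integration.\<close>

lemma J_sums:
  assumes x: "norm x < 1"
  shows "(\<lambda>j. (-1) ^ j / of_nat (Suc j) * of_real (LBINT t:{0<..<1}. k t * w t ^ Suc j)
              * e ^ Suc j * x ^ Suc j) sums J x"
proof -
  let ?I = "\<lambda>t. indicator {0<..<1::real} t :: real"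
  let ?c = "\<lambda>j. (-1) ^ j / of_nat (Suc j) * e ^ Suc j * x ^ Suc j"
  let ?f = "\<lambda>j t. (?I t * (k t * w t ^ Suc j)) *\<^sub>R ?c j"
  have ser: "(\<lambda>j. ?f j t) sums (?I t *\<^sub>R (of_real (k t) * Ln (1 + x * of_real (w t) * e)))" for t
  proof (cases "t \<in> {0<..<1}")
    case True
    then have w: "w t \<in> {0..1}" using w_range by auto
    have "norm (x * of_real (w t) * e) = norm x * w t" using w by (simp add: norm_mult norm_e)
    also have "\<dots> \<le> norm x" using w by (simp add: mult_left_le)
    finally have "norm (x * of_real (w t) * e) < 1" using x by simp
    \<comment> \<open>The library series starts at index 0, where the term vanishes because division
      by 0 gives 0; the index shift therefore keeps the sum.\<close>
    from Ln_series[OF this]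
    have "(\<lambda>j. (-1) ^ Suc (Suc j) / of_nat (Suc j) * (x * of_real (w t) * e) ^ Suc j) sums
        Ln (1 + x * of_real (w t) * e)" by (subst sums_Suc_iff) simp
    then have "(\<lambda>j. of_real (k t) * ((-1) ^ Suc (Suc j) / of_nat (Suc j) * (x * of_real (w t) * e) ^ Suc j)) sums
        (of_real (k t) * Ln (1 + x * of_real (w t) * e))" by (rule sums_mult)
    then show ?thesis using True
      by (simp add: scaleR_conv_of_real power_mult_distrib mult_ac)
  qed auto
  have int: "integrable lborel (?f j)" for j
    using kw_power_integrable[of j] unfolding set_integrable_def
    by (intro integrable_scaleR_left) (auto simp: mult_ac)
  have b: "norm (?f j t) \<le> ?I t * (k t * w t) * norm x ^ Suc j" for j t
  proof (cases "t \<in> {0<..<1}")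
    case True
    then have w: "w t \<in> {0..1}" using w_range by auto
    have "norm (?f j t) = k t * w t ^ Suc j * (norm x ^ Suc j / of_nat (Suc j))"
      using True k_nonneg[of t] w by (simp add: norm_mult norm_divide norm_power norm_e abs_mult del: power_Suc of_nat_Suc)
    also have "\<dots> \<le> k t * w t * (norm x ^ Suc j / 1)"
      using k_nonneg[of t] w power_decreasing[of 1 "Suc j" "w t"]
      by (intro mult_mono divide_left_mono) auto
    finally show ?thesis using True by simp
  qed auto
  have "(\<lambda>j. \<integral>t. ?f j t \<partial>lborel) sums (\<integral>t. (\<Sum>j. ?f j t) \<partial>lborel)"
  proof (rule sums_integral)
    show "integrable lborel (?f j)" for j by (rule int)
    have g: "summable (\<lambda>j. norm x ^ Suc j)" using x by (subst summable_Suc_iff) (simp add: summable_geometric)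
    show "AE t in lborel. summable (\<lambda>j. norm (?f j t))"
    proof (intro AE_I2)
      fix t
      show "summable (\<lambda>j. norm (?f j t))"
        by (rule summable_comparison_test'[OF summable_mult[OF g]]) (use b in \<open>simp only: real_norm_def abs_norm_cancel\<close>)
    qed
    show "summable (\<lambda>j. \<integral>t. norm (?f j t) \<partial>lborel)"
    proof (rule summable_comparison_test'[OF summable_mult[OF g]])
      fix j
      have "(\<integral>t. norm (?f j t) \<partial>lborel) \<le> (\<integral>t. ?I t * (k t * w t) * norm x ^ Suc j \<partial>lborel)"
      proof (rule integral_mono)
        show "integrable lborel (\<lambda>t. ?I t * (k t * w t) * norm x ^ Suc j)"
          using kw_integrable unfolding set_integrable_def
          by (intro integrable_mult_left) simp
      qed (rule integrable_norm[OF int], rule b)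
      then show "norm (\<integral>t. norm (?f j t) \<partial>lborel) \<le> (\<integral>t. ?I t * (k t * w t) \<partial>lborel) * norm x ^ Suc j"
        by simp
    qed
  qed
  moreover have "(\<integral>t. (\<Sum>j. ?f j t) \<partial>lborel) = J x"
    unfolding J_def set_lebesgue_integral_def sums_unique[symmetric, OF ser] ..
  moreover have "(\<integral>t. ?f j t \<partial>lborel) = of_real (LBINT t:{0<..<1}. k t * w t ^ Suc j) * ?c j" for j
  proof -
    have "integrable lborel (\<lambda>t. ?I t * (k t * w t ^ Suc j))"
      using kw_power_integrable[of j] unfolding set_integrable_def by simp
    then have "(\<integral>t. ?f j t \<partial>lborel) = (\<integral>t. ?I t * (k t * w t ^ Suc j) \<partial>lborel) *\<^sub>R ?c j"
      by (intro integral_scaleR_left)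
    then show ?thesis unfolding set_lebesgue_integral_def real_scaleR_def by (simp only: scaleR_conv_of_real)
  qed
  ultimately show ?thesis by (simp add: mult_ac)
qed

end

section \<open>Lagrange inversion\<close>

text \<open>Splits off the constant coefficient for the induction below. The difference quotient has
  a removable singularity at 0, and uniqueness of expansions identifies its coefficients.\<close>

lemma has_fps_expansion_divided_difference:
  assumes hol: "A holomorphic_on ball 0 \<rho>" and F: "A has_fps_expansion F" and \<rho>: "\<rho> > 0"
  obtains B where "B holomorphic_on ball 0 \<rho>" "B has_fps_expansion fps_shift 1 F"
    "\<And>x. A x = fps_nth F 0 + x * B x"
proof -
  have A0: "A 0 = fps_nth F 0" using has_fps_expansion_imp_0_eq_fps_nth_0[OF F] by simp
  define B where "B = (\<lambda>x. if x = 0 then deriv A 0 else (A x - fps_nth F 0) / x)"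
  have eq: "A x = fps_nth F 0 + x * B x" for x by (simp add: B_def A0)
  have B: "B holomorphic_on ball 0 \<rho>"
  proof (rule pole_theorem_open_0[where a = 0 and g = "\<lambda>x. A x - fps_nth F 0"])
    show "(\<lambda>x. A x - fps_nth F 0) holomorphic_on ball 0 \<rho>" using hol by (intro holomorphic_intros)
    have "A field_differentiable at 0" using hol \<rho> holomorphic_on_imp_differentiable_at by auto
    then show "B 0 = deriv (\<lambda>x. A x - fps_nth F 0) 0" by (simp add: B_def)
  qed (auto simp: A0 eq)
  define G where "G = fps_expansion B 0"
  have G: "B has_fps_expansion G" unfolding G_def using B \<rho>
    by (intro has_fps_expansion_fps_expansion[of "ball 0 \<rho>"]) auto
  have "(\<lambda>x. fps_nth F 0 + x * B x) has_fps_expansion fps_const (fps_nth F 0) + fps_X * G"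
    by (intro fps_expansion_intros G)
  also have "(\<lambda>x. fps_nth F 0 + x * B x) = A" using eq by auto
  finally have "F = fps_const (fps_nth F 0) + fps_X * G" using F fps_expansion_unique_complex by blast
  then have "fps_nth F (Suc j) = fps_nth (fps_const (fps_nth F 0) + fps_X * G) (Suc j)" for j by simp
  then have "fps_shift 1 F = G" by (simp add: fps_eq_iff)
  then show ?thesis using that[of B] B G eq by simp
qed

text \<open>Induction on \<open>k\<close>, splitting off the constant term of \<open>A\<close>: it contributes a multiple of
  \<open>P' / P\<^bsup>k+1\<^esup>\<close>, which has a primitive unless \<open>k = 0\<close>.\<close>

lemma has_contour_integral_compose_div_power:
  fixes c :: complex
  assumes P: "\<And>u. u \<in> ball c R \<Longrightarrow> P u = (u - c) * Q u"
    and Q: "Q holomorphic_on ball c R" "\<And>u. u \<in> ball c R \<Longrightarrow> Q u \<noteq> 0"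
    and r: "0 < r" "r < R" and \<rho>: "\<rho> > 0"
    and A: "A holomorphic_on ball 0 \<rho>" "A has_fps_expansion F"
    and PR: "P ` ball c R \<subseteq> ball 0 \<rho>"
  shows "((\<lambda>u. A (P u) * deriv P u / P u ^ Suc k) has_contour_integral 2 * pi * \<i> * fps_nth F k)
          (circlepath c r)"
  using A
proof (induction k arbitrary: A F)
  have hP: "P holomorphic_on ball c R"
    by (rule holomorphic_transform[of "\<lambda>u. (u - c) * Q u"]) (use Q P in \<open>auto intro!: holomorphic_intros\<close>)
  have dP: "(P has_field_derivative deriv P u) (at u)" if "u \<in> ball c R" for u
    using hP that holomorphic_derivI open_ball by blast
  have dQ: "(Q has_field_derivative deriv Q u) (at u)" if "u \<in> ball c R" for u
    using Q(1) that holomorphic_derivI open_ball by blast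
  have hdP: "deriv P holomorphic_on ball c R" using hP by (intro holomorphic_deriv) auto
  have hdQ: "deriv Q holomorphic_on ball c R" using Q by (intro holomorphic_deriv) auto
  \<comment> \<open>As \<open>Q\<close> has no zeros, \<open>P\<close> vanishes only at the centre,
    which is not on the circle.\<close>
  have in_ball: "u \<in> ball c R" and Pnz: "P u \<noteq> 0" and nc: "u \<noteq> c"
    if "u \<in> path_image (circlepath c r)" for u
  proof -
    show 1: "u \<in> ball c R" "u \<noteq> c" using that r by (auto simp: path_image_circlepath)
    show "P u \<noteq> 0" using P[OF 1(1)] Q(2)[OF 1(1)] 1(2) by simp
  qed
  have zero: "(f has_contour_integral 0) (circlepath c r)" if "f holomorphic_on ball c R" for f
    using that in_ball by (intro Cauchy_theorem_convex_simple[of _ "ball c R"]) auto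
  have hB: "(\<lambda>u. B (P u) * deriv P u) holomorphic_on ball c R" if "B holomorphic_on ball 0 \<rho>" for B
    using holomorphic_on_compose_gen[OF hP that PR] hdP
    unfolding o_def by (rule holomorphic_on_mult)
  {
    case (0 A F)
    obtain B where B: "B holomorphic_on ball 0 \<rho>" "B has_fps_expansion fps_shift 1 F"
      "\<And>x. A x = fps_nth F 0 + x * B x"
      using has_fps_expansion_divided_difference[OF 0 \<rho>] by metis
    \<comment> \<open>The logarithmic derivative of \<open>P\<close> splits into
      \<open>1 / (u - c)\<close>, which produces the residue, and the holomorphic
      \<open>deriv Q u / Q u\<close>, which integrates to 0.\<close>
    have 1: "((\<lambda>u. 1 / (u - c)) has_contour_integral 2 * pi * \<i>) (circlepath c r)"
      using Cauchy_integral_circlepath_simple[of "\<lambda>_. 1" c r c] r by simp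
    have 2: "((\<lambda>u. deriv Q u / Q u) has_contour_integral 0) (circlepath c r)"
      using Q hdQ by (intro zero holomorphic_on_divide)
    have "((\<lambda>u. fps_nth F 0 * (1 / (u - c) + deriv Q u / Q u) + B (P u) * deriv P u)
        has_contour_integral fps_nth F 0 * (2 * pi * \<i> + 0) + 0) (circlepath c r)"
      by (intro has_contour_integral_add has_contour_integral_lmul 1 2 zero hB B)
    then have "((\<lambda>u. A (P u) * deriv P u / P u ^ Suc 0)
        has_contour_integral fps_nth F 0 * (2 * pi * \<i> + 0) + 0) (circlepath c r)"
    proof (rule has_contour_integral_eq)
      fix u assume u: "u \<in> path_image (circlepath c r)"
      have "((\<lambda>u. (u - c) * Q u) has_field_derivative Q u + (u - c) * deriv Q u) (at u)"
        using dQ[OF in_ball[OF u]] by (auto intro!: derivative_eq_intros)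
      then have "(P has_field_derivative Q u + (u - c) * deriv Q u) (at u)"
        using in_ball[OF u] by (rule has_field_derivative_transform_within_open[OF _ open_ball]) (simp add: P)
      then have "deriv P u = Q u + (u - c) * deriv Q u" by (rule DERIV_imp_deriv)
      then have "1 / (u - c) + deriv Q u / Q u = deriv P u / P u"
        using P[OF in_ball[OF u]] Q(2)[OF in_ball[OF u]] nc[OF u] by (simp add: add_frac_eq add.commute)
      then show "fps_nth F 0 * (1 / (u - c) + deriv Q u / Q u) + B (P u) * deriv P u =
          A (P u) * deriv P u / P u ^ Suc 0"
        using Pnz[OF u] by (simp only: B(3)) (simp add: field_simps)
    qed
    then show ?case by (simp add: mult_ac)
  next
    case (Suc k A F)
    obtain B where B: "B holomorphic_on ball 0 \<rho>" "B has_fps_expansion fps_shift 1 F"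
      "\<And>x. A x = fps_nth F 0 + x * B x"
      using has_fps_expansion_divided_difference[OF Suc.prems \<rho>] by metis
    \<comment> \<open>The primitive is \<open>- 1 / ((k + 1) * P u ^ Suc k)\<close>.\<close>
    have "((\<lambda>u. deriv P u / P u ^ Suc (Suc k)) has_contour_integral 0) (circlepath c r)"
    proof (rule Cauchy_theorem_primitive[where S = "path_image (circlepath c r)"])
      fix u assume u: "u \<in> path_image (circlepath c r)"
      have "((\<lambda>u. inverse (P u ^ Suc k)) has_field_derivative
          - (inverse (P u ^ Suc k) * ((1 + of_nat k) * (deriv P u * P u ^ k)) * inverse (P u ^ Suc k))) (at u)"
        using Pnz[OF u] by (intro DERIV_inverse' DERIV_power_Suc dP in_ball u) auto
      then have "((\<lambda>u. - (1 / (1 + of_nat k)) * inverse (P u ^ Suc k)) has_field_derivative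
          - (1 / (1 + of_nat k)) *
          - (inverse (P u ^ Suc k) * ((1 + of_nat k) * (deriv P u * P u ^ k)) * inverse (P u ^ Suc k))) (at u)"
        by (rule DERIV_cmult)
      also have "- (1 / (1 + of_nat k)) *
          - (inverse (P u ^ Suc k) * ((1 + of_nat k) * (deriv P u * P u ^ k)) * inverse (P u ^ Suc k)) =
          ((1 / (1 + of_nat k)) * (1 + of_nat k)) * deriv P u * (P u ^ k * inverse (P u ^ Suc k)) * inverse (P u ^ Suc k)"
        by (simp only: mult_ac minus_mult_minus)
      also have "(1 / (1 + of_nat k)) * (1 + of_nat k) = (1 :: complex)"
        by (metis nonzero_divide_eq_eq of_nat_Suc of_nat_neq_0)
      also have "1 * deriv P u * (P u ^ k * inverse (P u ^ Suc k)) * inverse (P u ^ Suc k) =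
          deriv P u / P u ^ Suc (Suc k)"
        using Pnz[OF u] by (simp add: field_simps)
      finally show "((\<lambda>u. - (1 / (1 + of_nat k)) * inverse (P u ^ Suc k)) has_field_derivative
          deriv P u / P u ^ Suc (Suc k)) (at u within path_image (circlepath c r))"
        by (rule has_field_derivative_at_within)
    qed (use r in auto)
    then have "((\<lambda>u. fps_nth F 0 * (deriv P u / P u ^ Suc (Suc k)) + B (P u) * deriv P u / P u ^ Suc k)
        has_contour_integral fps_nth F 0 * 0 + 2 * pi * \<i> * fps_nth (fps_shift 1 F) k) (circlepath c r)"
      by (intro has_contour_integral_add has_contour_integral_lmul Suc.IH B)
    then have "((\<lambda>u. A (P u) * deriv P u / P u ^ Suc (Suc k))
        has_contour_integral fps_nth F 0 * 0 + 2 * pi * \<i> * fps_nth (fps_shift 1 F) k) (circlepath c r)"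
      by (rule has_contour_integral_eq) (use Pnz in \<open>simp add: B(3) field_simps\<close>)
    then show ?case by simp
  }
qed

text \<open>Here \<open>g\<close> is the composition of \<open>G\<close> with the local inverse of \<open>P\<close>.\<close>

lemma Lagrange_inversion:
  fixes c :: complex
  assumes P: "\<And>u. u \<in> ball c R \<Longrightarrow> P u = (u - c) * Q u"
    and Q: "Q holomorphic_on ball c R" "\<And>u. u \<in> ball c R \<Longrightarrow> Q u \<noteq> 0"
    and R: "R > 0" and \<rho>: "\<rho> > 0"
    and g: "g holomorphic_on ball 0 \<rho>"
    and PR: "P ` ball c R \<subseteq> ball 0 \<rho>"
    and gP: "\<And>u. u \<in> ball c R \<Longrightarrow> g (P u) = G u"
  shows "(deriv ^^ Suc k) g 0 = (deriv ^^ k) (\<lambda>u. deriv G u / Q u ^ Suc k) c"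
proof -
  define r where "r = R / 2"
  have r: "0 < r" "r < R" using R by (auto simp: r_def)
  have hP: "P holomorphic_on ball c R"
    by (rule holomorphic_transform[of "\<lambda>u. (u - c) * Q u"]) (use Q P in \<open>auto intro!: holomorphic_intros\<close>)
  have hG: "G holomorphic_on ball c R"
    by (rule holomorphic_transform[OF holomorphic_on_compose_gen[OF hP g PR]]) (simp add: gP)
  have dg: "deriv g holomorphic_on ball 0 \<rho>" using g by (intro holomorphic_deriv) auto
  then have F: "deriv g has_fps_expansion fps_expansion (deriv g) 0"
    using \<rho> by (intro has_fps_expansion_fps_expansion[of "ball 0 \<rho>"]) auto
  \<comment> \<open>One contour integral is evaluated twice: as a Taylor coefficient of
    \<open>deriv g\<close>, and by Cauchy's formula as a derivative at \<open>c\<close>. The chain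
    rule for \<open>g (P u) = G u\<close> matches the integrands; passing to \<open>deriv g\<close>
    accounts for the order \<open>Suc k\<close> on the left of the result.\<close>
  have 1: "((\<lambda>u. deriv g (P u) * deriv P u / P u ^ Suc k) has_contour_integral
     2 * pi * \<i> * fps_nth (fps_expansion (deriv g) 0) k) (circlepath c r)"
    by (rule has_contour_integral_compose_div_power[OF P Q r \<rho> dg F PR])
  have hGQ: "(\<lambda>u. deriv G u / Q u ^ Suc k) holomorphic_on ball c R"
    using hG Q by (intro holomorphic_intros holomorphic_deriv) auto
  have 2: "((\<lambda>u. (deriv G u / Q u ^ Suc k) / (u - c) ^ Suc k) has_contour_integral
      2 * pi * \<i> / fact k * (deriv ^^ k) (\<lambda>u. deriv G u / Q u ^ Suc k) c) (circlepath c r)"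
  proof (rule Cauchy_has_contour_integral_higher_derivative_circlepath)
    have "cball c r \<subseteq> ball c R" using r by auto
    then show "continuous_on (cball c r) (\<lambda>u. deriv G u / Q u ^ Suc k)"
      using hGQ holomorphic_on_imp_continuous_on holomorphic_on_subset by metis
    have "ball c r \<subseteq> ball c R" using r by auto
    then show "(\<lambda>u. deriv G u / Q u ^ Suc k) holomorphic_on ball c r"
      using hGQ holomorphic_on_subset by metis
  qed (use r in auto)
  have "deriv g (P u) * deriv P u / P u ^ Suc k = (deriv G u / Q u ^ Suc k) / (u - c) ^ Suc k"
    if "u \<in> path_image (circlepath c r)" for u
  proof -
    have u: "u \<in> ball c R" using that r by (auto simp: path_image_circlepath)
    have "(P has_field_derivative deriv P u) (at u)" using hP u holomorphic_derivI open_ball by blast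
    moreover have "(g has_field_derivative deriv g (P u)) (at (P u))"
      using g u PR by (intro holomorphic_derivI[of _ "ball 0 \<rho>"]) (blast | simp)+
    ultimately have "((\<lambda>u. g (P u)) has_field_derivative deriv g (P u) * deriv P u) (at u)"
      by (rule DERIV_chain2[rotated])
    then have "(G has_field_derivative deriv g (P u) * deriv P u) (at u)"
      using u by (rule has_field_derivative_transform_within_open[OF _ open_ball]) (simp add: gP)
    then have "deriv G u = deriv g (P u) * deriv P u" by (rule DERIV_imp_deriv)
    then show ?thesis using P[OF u] by (simp add: power_mult_distrib mult_ac)
  qed
  then have "((\<lambda>u. (deriv G u / Q u ^ Suc k) / (u - c) ^ Suc k) has_contour_integral
     2 * pi * \<i> * fps_nth (fps_expansion (deriv g) 0) k) (circlepath c r)"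
    by (rule has_contour_integral_eq[OF 1])
  then have "2 * pi * \<i> * fps_nth (fps_expansion (deriv g) 0) k =
      2 * pi * \<i> / fact k * (deriv ^^ k) (\<lambda>u. deriv G u / Q u ^ Suc k) c"
    using contour_integral_unique[OF 2] contour_integral_unique by metis
  then have "fact k * fps_nth (fps_expansion (deriv g) 0) k = (deriv ^^ k) (\<lambda>u. deriv G u / Q u ^ Suc k) c"
    by (simp add: field_simps)
  then show ?thesis by (simp add: fps_expansion_def funpow_Suc_right del: funpow.simps power_Suc)
qed

section \<open>The root branch at the origin\<close>

text \<open>The trinomial equation solved for \<open>x\<close>; its local inverse at \<open>1\<close> is the principal root.\<close>

definition trin_param :: "nat \<Rightarrow> complex \<Rightarrow> complex" where
  "trin_param n z = 1 / z ^ (n - 1) - z"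

lemma trin_param_eq_iff:
  assumes "n \<ge> 1" "z \<noteq> 0"
  shows "trin_param n z = x \<longleftrightarrow> z ^ n + x * z ^ (n - 1) - 1 = 0"
proof -
  have "z ^ n = z * z ^ (n - 1)" using assms(1) by (simp add: power_eq_if)
  then show ?thesis using assms(2) by (auto simp: trin_param_def field_simps)
qed

lemma ball_1_1_Re: "z \<in> ball 1 1 \<Longrightarrow> Re z > 0"
  using abs_Re_le_cmod[of "1 - z"] by (auto simp: dist_norm)

lemma ball_1_1_not_nonpos_Reals: "z \<in> ball (1::complex) 1 \<Longrightarrow> z \<notin> \<real>\<^sub>\<le>\<^sub>0"
  using ball_1_1_Re complex_nonpos_Reals_iff by force

lemma trin_param_holomorphic: "trin_param n holomorphic_on ball 1 1"
  unfolding trin_param_def [abs_def] using ball_1_1_not_nonpos_Reals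
  by (intro holomorphic_intros) fastforce

text \<open>The derivative at 1 is \<open>- n\<close>, hence nonzero. A radius of at most 1 keeps
  the ball in the right half-plane, away from 0 and the branch cut.\<close>

lemma trin_param_locally_injective:
  assumes "n \<ge> 1"
  obtains r where "r > 0" "r \<le> 1" "inj_on (trin_param n) (ball 1 r)"
proof -
  have "(trin_param n has_field_derivative - of_nat (n - 1) - 1) (at 1)"
    unfolding trin_param_def [abs_def] by (auto intro!: derivative_eq_intros)
  then have "deriv (trin_param n) 1 = - of_nat (n - 1) - 1" by (rule DERIV_imp_deriv)
  also have "\<dots> = - of_nat n" using assms by (simp add: of_nat_diff)
  finally have "deriv (trin_param n) 1 \<noteq> 0" using assms by simp
  then obtain r where "r > 0" "ball 1 r \<subseteq> ball (1::complex) 1" "inj_on (trin_param n) (ball 1 r)"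
    using has_complex_derivative_locally_injective[OF trin_param_holomorphic, of 1 n]
    by (metis centre_in_ball open_ball zero_less_one)
  then show ?thesis using that[of "min r 1"] inj_on_subset[of "trin_param n" "ball 1 r" "ball 1 (min r 1)"]
    by (simp add: subset_ball)
qed

text \<open>By continuity both functions are close to 1 near 0, where \<open>trin_param n\<close> is
  injective, and \<open>trin_param n\<close> maps both values back to \<open>x\<close>.\<close>

lemma trinomial_root_locally_unique:
  fixes z1 z2 :: "complex \<Rightarrow> complex"
  assumes n: "n \<ge> 1"
    and z: "isCont z1 0" "z1 0 = 1" "isCont z2 0" "z2 0 = 1"
    and eq: "\<forall>\<^sub>F x in nhds 0. z1 x ^ n + x * z1 x ^ (n - 1) - 1 = 0"
      "\<forall>\<^sub>F x in nhds 0. z2 x ^ n + x * z2 x ^ (n - 1) - 1 = 0"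
  shows "\<forall>\<^sub>F x in nhds 0. z1 x = z2 x"
proof -
  obtain r where r: "r > 0" "r \<le> 1" "inj_on (trin_param n) (ball 1 r)"
    using trin_param_locally_injective[OF n] by blast
  have ev: "\<forall>\<^sub>F x in nhds 0. f x \<in> ball 1 r" if "isCont f 0" "f 0 = 1" for f :: "complex \<Rightarrow> complex"
  proof -
    have "(f \<longlongrightarrow> f 0) (nhds 0)" using that(1) tendsto_at_iff_tendsto_nhds isCont_def by blast
    then show ?thesis using that(2) r(1) by (intro topological_tendstoD) auto
  qed
  show ?thesis using ev[OF z(1,2)] ev[OF z(3,4)] eq
  proof eventually_elim
    case (elim x)
    have "z1 x \<noteq> 0" "z2 x \<noteq> 0" using elim(1,2) r(2) by auto
    then have "trin_param n (z1 x) = x" "trin_param n (z2 x) = x"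
      using elim(3,4) trin_param_eq_iff[OF n] by auto
    then show ?case using elim(1,2) r(3) by (metis inj_onD)
  qed
qed

lemma higher_deriv_powr_1:
  "(deriv ^^ k) (\<lambda>u. C * u powr b) 1 = C * (fact k * (b gchoose k))" for b C :: complex
proof -
  have "(\<lambda>x. C * (1 + x) powr b) has_fps_expansion fps_const C * fps_binomial b"
    by (intro fps_expansion_intros)
  from fps_nth_fps_expansion[OF this, of k]
  have "(deriv ^^ k) (\<lambda>x. C * (1 + x) powr b) 0 = C * (fact k * (b gchoose k))"
    by (simp add: field_simps)
  moreover have "(deriv ^^ k) (\<lambda>u. C * u powr b) 1 = (deriv ^^ k) (\<lambda>x. C * (1 + x) powr b) 0"
    by (subst higher_deriv_shift_0) (simp add: o_def)
  ultimately show ?thesis by simp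
qed

lemma powr_inverse_power:
  assumes "n \<ge> 1" "u \<noteq> 0"
  shows "(u powr (1 / of_nat n)) ^ n = (u::complex)"
  using assms by (simp add: powr_def exp_of_nat_mult[symmetric])

text \<open>Dividing \<open>Ln u\<close> by \<open>n\<close> keeps the imaginary part strictly
  between \<open>- pi\<close> and \<open>pi\<close>, so \<open>Ln\<close> undoes \<open>exp\<close>
  and the principal square root just halves the exponent.\<close>

lemma csqrt_powr_inverse:
  assumes "n \<ge> 1" "u \<notin> \<real>\<^sub>\<le>\<^sub>0"
  shows "csqrt (u powr (1 / of_nat n)) = u powr (1 / (2 * of_nat n))"
proof -
  have u: "u \<noteq> 0" using assms(2) by auto
  have "\<bar>Im (Ln u)\<bar> < pi" using Im_Ln_less_pi[OF assms(2)] mpi_less_Im_Ln[OF u] by (simp add: abs_less_iff)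
  moreover have "\<bar>Im (Ln u / of_nat n)\<bar> \<le> \<bar>Im (Ln u)\<bar>"
    using assms(1) by (simp add: abs_div divide_le_eq mult_le_cancel_left1)
  ultimately have "Ln (exp (Ln u / of_nat n)) = Ln u / of_nat n"
    by (intro Ln_exp) linarith+
  then show ?thesis using u by (simp add: powr_def csqrt_exp_Ln mult.commute)
qed

text \<open>Lagrange inversion is applied in the variable \<open>u = z\<^sup>n\<close>, in which \<open>x = (1 - u) u\<^bsup>1/n-1\<^esup>\<close>, so that
  the coefficients are Taylor coefficients of a single power of \<open>u\<close>.\<close>

lemma trinomial_sqrt_branch:
  assumes n: "n \<ge> 1"
  obtains g \<rho> where "\<rho> > 0" "g holomorphic_on ball 0 \<rho>" "g 0 = 1"
    "\<And>x. x \<in> ball 0 \<rho> \<Longrightarrow> ((g x)\<^sup>2) ^ n + x * ((g x)\<^sup>2) ^ (n - 1) - 1 = 0"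
    "\<And>k. (deriv ^^ Suc k) g 0 = (-1) ^ Suc k / (2 * of_nat n) *
        (fact k * ((of_nat k - (2 * of_nat k + 1) / (2 * of_nat n)) gchoose k))"
proof -
  obtain r where r: "r > 0" "r \<le> 1" "inj_on (trin_param n) (ball 1 r)"
    using trin_param_locally_injective[OF n] by blast
  have sub: "ball 1 r \<subseteq> ball (1::complex) 1" using r(2) by auto
  have hol: "trin_param n holomorphic_on ball 1 r"
    using trin_param_holomorphic holomorphic_on_subset sub by blast
  \<comment> \<open>By the open mapping theorem \<open>V\<close> is a neighbourhood of 0; the
    inverse \<open>Z\<close> on it is the local root branch.\<close>
  define V where "V = trin_param n ` ball 1 r"
  have V: "open V" unfolding V_def using hol r(3) by (intro open_mapping_thm3) auto
  have p1: "trin_param n 1 = 0" by (simp add: trin_param_def)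
  then have "0 \<in> V" using r(1) unfolding V_def by (metis centre_in_ball imageI)
  then obtain \<rho> where \<rho>: "\<rho> > 0" "ball 0 \<rho> \<subseteq> V" using V open_contains_ball by metis
  obtain Z where Z: "Z holomorphic_on V" "\<And>z. z \<in> ball 1 r \<Longrightarrow> Z (trin_param n z) = z"
    unfolding V_def using holomorphic_has_inverse[OF hol open_ball r(3)] by metis
  have Zr: "Z x \<in> ball 1 r" "trin_param n (Z x) = x" if "x \<in> V" for x
    using that Z(2) unfolding V_def by auto
  \<comment> \<open>The square root of the branch is expanded, because the claimed formula is a
    square. It is holomorphic since \<open>Z\<close> stays off the branch cut.\<close>
  define g where "g = (\<lambda>x. csqrt (Z x))"
  have hg: "g holomorphic_on ball 0 \<rho>" unfolding g_def
  proof (intro holomorphic_on_csqrt')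
    show "Z holomorphic_on ball 0 \<rho>" using Z(1) \<rho>(2) holomorphic_on_subset by blast
    show "\<And>x. x \<in> ball 0 \<rho> \<Longrightarrow> Z x \<notin> \<real>\<^sub>\<le>\<^sub>0"
      using Zr \<rho>(2) sub ball_1_1_not_nonpos_Reals by blast
  qed
  have g0: "g 0 = 1" using Z(2)[of 1] r(1) p1 by (simp add: g_def)
  have eq: "((g x)\<^sup>2) ^ n + x * ((g x)\<^sup>2) ^ (n - 1) - 1 = 0" if "x \<in> ball 0 \<rho>" for x
  proof -
    have x: "x \<in> V" using that \<rho>(2) by blast
    have "Z x \<noteq> 0" using Zr(1)[OF x] sub ball_1_1_not_nonpos_Reals by fastforce
    then show ?thesis using Zr(2)[OF x] trin_param_eq_iff[OF n] by (simp add: g_def)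
  qed
  define v where "v = (\<lambda>u::complex. u powr (1 / of_nat n))"
  define P where "P = (\<lambda>u. trin_param n (v u))"
  \<comment> \<open>\<open>Q\<close> is the quotient of \<open>P u\<close> by \<open>u - 1\<close>,
    which explains the minus sign; \<open>G\<close> is what \<open>g\<close> becomes after
    substituting \<open>P u\<close>.\<close>
  define Q where "Q = (\<lambda>u::complex. - (u powr (1 / of_nat n - 1)))"
  define G where "G = (\<lambda>u::complex. u powr (1 / (2 * of_nat n)))"
  have v1: "v 1 = 1" by (simp add: v_def)
  have hv: "v holomorphic_on ball 1 1" unfolding v_def
    using ball_1_1_not_nonpos_Reals by (intro holomorphic_intros) auto
  have cv: "isCont v 1" using hv holomorphic_on_imp_continuous_on continuous_on_eq_continuous_at
    by (metis centre_in_ball open_ball zero_less_one)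
  have "\<forall>\<^sub>F u in nhds 1. v u \<in> ball 1 r"
  proof -
    have "(v \<longlongrightarrow> v 1) (nhds 1)" using cv tendsto_at_iff_tendsto_nhds isCont_def by blast
    then show ?thesis using v1 r(1) by (intro topological_tendstoD) auto
  qed
  moreover have "\<forall>\<^sub>F u in nhds 1. P u \<in> ball 0 \<rho>"
  proof -
    have "isCont (trin_param n) (v 1)" unfolding v1
      using trin_param_holomorphic holomorphic_on_imp_continuous_on continuous_on_eq_continuous_at
      by (metis centre_in_ball open_ball zero_less_one)
    with cv have "isCont P 1" unfolding P_def by (rule isCont_o2)
    then have "(P \<longlongrightarrow> P 1) (nhds 1)" using tendsto_at_iff_tendsto_nhds isCont_def by blast
    then show ?thesis using v1 p1 \<rho>(1) by (intro topological_tendstoD) (auto simp: P_def)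
  qed
  moreover have "\<forall>\<^sub>F u in nhds 1. u \<in> ball (1::complex) 1" by (intro eventually_nhds_in_open) auto
  ultimately have "\<forall>\<^sub>F u in nhds 1. v u \<in> ball 1 r \<and> P u \<in> ball 0 \<rho> \<and> u \<in> ball 1 1"
    by eventually_elim auto
  then obtain R where R: "R > 0"
    "\<And>u::complex. u \<in> ball 1 R \<Longrightarrow> v u \<in> ball 1 r \<and> P u \<in> ball 0 \<rho> \<and> u \<in> ball 1 1"
    unfolding eventually_nhds_metric by (auto simp: dist_commute)
  have nz: "u \<notin> \<real>\<^sub>\<le>\<^sub>0" "u \<noteq> 0" if "u \<in> ball 1 R" for u :: complex
    using R(2)[OF that] ball_1_1_not_nonpos_Reals[of u] by auto
  have coeff: "(deriv ^^ Suc k) g 0 = (-1) ^ Suc k / (2 * of_nat n) *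
        (fact k * ((of_nat k - (2 * of_nat k + 1) / (2 * of_nat n)) gchoose k))" for k
  proof -
    \<comment> \<open>The exponent left when \<open>deriv G u\<close>, of exponent
      \<open>1 / (2n) - 1\<close>, is divided by \<open>Suc k\<close> factors of exponent
      \<open>1 / n - 1\<close>.\<close>
    define b where "b = (of_nat k - (2 * of_nat k + 1) / (2 * of_nat n) :: complex)"
    have "(deriv ^^ Suc k) g 0 = (deriv ^^ k) (\<lambda>u. deriv G u / Q u ^ Suc k) 1"
    proof (rule Lagrange_inversion[where P = P and R = R])
      fix u :: complex assume u: "u \<in> ball 1 R"
      have vn: "v u ^ n = u" unfolding v_def using n nz[OF u] by (intro powr_inverse_power)
      have v0: "v u \<noteq> 0" using nz[OF u] by (simp add: v_def powr_def)
      have "v u ^ (n - 1) = u / v u" using vn v0 n by (simp add: power_eq_if field_simps)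
      then have "P u = v u / u - v u" by (simp add: P_def trin_param_def)
      also have "\<dots> = (u - 1) * - (v u / u)" using nz[OF u] by (simp add: field_simps)
      also have "v u / u = u powr (1 / of_nat n - 1)" using nz[OF u] by (simp add: v_def powr_diff)
      finally show "P u = (u - 1) * Q u" by (simp add: Q_def)
      show "Q u \<noteq> 0" using nz[OF u] by (simp add: Q_def powr_def)
      show "g (P u) = G u"
        using R(2)[OF u] csqrt_powr_inverse[OF n nz(1)[OF u]] by (simp add: g_def P_def Z(2) G_def v_def)
    next
      show "Q holomorphic_on ball 1 R" unfolding Q_def
        using nz by (intro holomorphic_intros) auto
    qed (use R \<rho> hg in auto)
    also have "\<dots> = (deriv ^^ k) (\<lambda>u. (-1) ^ Suc k / (2 * of_nat n) * u powr b) 1"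
    proof (rule higher_deriv_cong_ev[OF _ refl])
      have "\<forall>\<^sub>F u in nhds 1. u \<in> ball (1::complex) R" using R(1) by (intro eventually_nhds_in_open) auto
      then show "\<forall>\<^sub>F u in nhds 1. deriv G u / Q u ^ Suc k = (-1) ^ Suc k / (2 * of_nat n) * u powr b"
      proof eventually_elim
        case (elim u)
        have "(G has_field_derivative (1 / (2 * of_nat n)) * u powr (1 / (2 * of_nat n) - 1)) (at u)"
          unfolding G_def using nz[OF elim] by (intro has_field_derivative_powr)
        then have 1: "deriv G u = (1 / (2 * of_nat n)) * u powr (1 / (2 * of_nat n) - 1)"
          by (rule DERIV_imp_deriv)
        have 2: "Q u ^ Suc k = (-1) ^ Suc k * u powr (of_nat (Suc k) * (1 / of_nat n - 1))"
          unfolding Q_def power_minus[of "u powr _"] using nz[OF elim]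
          by (simp add: powr_def exp_of_nat_mult[symmetric] mult_ac del: power_Suc of_nat_Suc)
        have "b = (1 / (2 * of_nat n) - 1) - of_nat (Suc k) * (1 / of_nat n - 1)"
          using n by (simp add: b_def field_simps)
        then have 3: "u powr b = u powr (1 / (2 * of_nat n) - 1) / u powr (of_nat (Suc k) * (1 / of_nat n - 1))"
          using powr_diff by metis
        have "x / ((-1) ^ Suc k * y) = (-1) ^ Suc k * (x / y)" for x y :: complex
          by (cases "even k") auto
        then show ?case unfolding 1 2 3 by (simp del: power_Suc of_nat_Suc)
      qed
    qed
    finally show ?thesis unfolding higher_deriv_powr_1 b_def .
  qed
  show ?thesis by (rule that[OF \<rho>(1) hg g0 eq coeff])
qed

section \<open>Moments of the kernel\<close>

text \<open>The denominator of the Beta value is \<open>Gamma (j + 1) = fact j\<close>. Reflection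
  replaces the sine times \<open>Gamma a\<close> by \<open>pi / Gamma (1 - a)\<close>, and the
  remaining Gamma quotient is a Pochhammer symbol.\<close>

lemma sin_times_Beta:
  fixes a :: real
  assumes a: "a > 0" "complex_of_real (1 - a) \<notin> \<int>\<^sub>\<le>\<^sub>0"
  shows "sin (of_real (pi * a)) * of_real (Beta (real (Suc j) - a) a) =
    of_real pi * ((of_nat j - complex_of_real a) gchoose j)"
proof -
  let ?a = "complex_of_real a"
  have na: "?a \<notin> \<int>\<^sub>\<le>\<^sub>0"
  proof
    assume "?a \<in> \<int>\<^sub>\<le>\<^sub>0"
    then obtain m where "m \<le> 0" "?a = of_int m" by (auto elim: nonpos_Ints_cases)
    then have "Re ?a = Re (of_int m)" by (simp only:)
    then show False using a(1) \<open>m \<le> 0\<close> by simp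
  qed
  have refl: "Gamma ?a * Gamma (1 - ?a) = of_real pi / sin (of_real pi * ?a)"
    by (rule Gamma_reflection_complex)
  have G: "Gamma ?a \<noteq> 0" "Gamma (1 - ?a) \<noteq> 0" using na a(2) by (simp_all add: Gamma_eq_zero_iff)
  \<comment> \<open>A zero sine would make the right side of \<open>refl\<close> equal to 0 by the
    convention for division, while the left side is nonzero.\<close>
  then have "sin (of_real pi * ?a) \<noteq> 0" using refl by auto
  then have refl': "sin (of_real pi * ?a) * Gamma ?a = of_real pi / Gamma (1 - ?a)"
    using refl G by (simp add: field_simps)
  have "of_real (Beta (real (Suc j) - a) a) = Beta (of_nat (Suc j) - ?a) ?a"
    by (simp flip: Beta_complex_of_real)
  also have "\<dots> = Gamma (1 - ?a + of_nat j) * Gamma ?a / fact j"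
    using Gamma_fact[of j, where ?'a = complex] by (simp add: Beta_def algebra_simps)
  finally have "sin (of_real (pi * a)) * of_real (Beta (real (Suc j) - a) a) =
      (sin (of_real pi * ?a) * Gamma ?a) * Gamma (1 - ?a + of_nat j) / fact j" by simp
  also have "\<dots> = of_real pi * (Gamma (1 - ?a + of_nat j) / Gamma (1 - ?a)) / fact j"
    unfolding refl' by simp
  also have "Gamma (1 - ?a + of_nat j) / Gamma (1 - ?a) = pochhammer (1 - ?a) j"
    using a(2) by (simp add: pochhammer_Gamma)
  finally show ?thesis by (simp add: gbinomial_pochhammer' algebra_simps)
qed

text \<open>Parity: an integer value would make the odd number \<open>2 * j + 1\<close> a multiple
  of \<open>2 * n\<close>. This supplies the side condition of
  \<open>sin_times_Beta\<close>.\<close>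

lemma odd_over_even_notin_nonpos_Ints:
  assumes "n \<ge> 1"
  shows "complex_of_real (1 - (2 * real j + 1) / (2 * real n)) \<notin> \<int>\<^sub>\<le>\<^sub>0"
proof
  assume "complex_of_real (1 - (2 * real j + 1) / (2 * real n)) \<in> \<int>\<^sub>\<le>\<^sub>0"
  then obtain m :: int where "complex_of_real (1 - (2 * real j + 1) / (2 * real n)) = of_int m"
    by (auto elim!: nonpos_Ints_cases)
  then have "1 - (2 * real j + 1) / (2 * real n) = of_int m"
    by (metis of_real_eq_iff of_real_of_int_eq)
  then have "2 * real n * (1 - of_int m) = 2 * real j + 1" using assms by (simp add: field_simps)
  then have "real_of_int (2 * int n * (1 - m)) = real_of_int (2 * int j + 1)" by simp
  then have "2 * int n * (1 - m) = 2 * int j + 1" by (simp only: of_int_eq_iff)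
  then have "even (2 * int j + 1)" by (metis dvd_mult2 dvd_triv_left)
  then show False by simp
qed

text \<open>The real factor of \<open>trin_integrand\<close>. Its singularity at
  \<open>t = 1\<close> is not integrable; one factor \<open>trin_weight n t\<close> repairs
  this.\<close>

definition trin_kernel :: "nat \<Rightarrow> real \<Rightarrow> real" where
  "trin_kernel n t = t powr (1 / (2 * real n) - 1) * (1 - t) powr (- (1 / (2 * real n)) - 1)"

text \<open>Adding exponents gives a Beta integrand. The case \<open>j = 0\<close> also provides the
  integrability of \<open>k * w\<close> that the locale demands.\<close>

lemma trin_kernel_moments:
  assumes n: "n \<ge> 2"
  defines "a \<equiv> \<lambda>j::nat. (2 * real j + 1) / (2 * real n)"
  shows "set_integrable lborel {0<..<1} (\<lambda>t. trin_kernel n t * trin_weight n t ^ Suc j)"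
    and "(LBINT t:{0<..<1}. trin_kernel n t * trin_weight n t ^ Suc j) = Beta (real (Suc j) - a j) (a j)"
proof -
  have a: "a j > 0" using n by (simp add: a_def)
  \<comment> \<open>Both Beta parameters must be positive; for the first this says
    \<open>2 * j + 1 < 2 * n * (j + 1)\<close>.\<close>
  have "2 * real j + 1 < real (Suc j) * 2" by simp
  also have "\<dots> \<le> real (Suc j) * (2 * real n)" using n by (intro mult_left_mono) auto
  finally have a': "real (Suc j) - a j > 0" using n by (simp add: a_def field_simps)
  let ?b = "\<lambda>t. t powr (real (Suc j) - a j - 1) * (1 - t) powr (a j - 1)"
  have eq: "trin_kernel n t * trin_weight n t ^ Suc j = ?b t" if "t \<in> {0<..<1}" for t
  proof -
    have t: "t > 0" "1 - t > 0" using that by auto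
    have "trin_weight n t ^ Suc j =
        t powr ((real n - 1) / real n * real (Suc j)) * (1 - t) powr (1 / real n * real (Suc j))"
      unfolding trin_weight_def power_mult_distrib using t
      by (simp add: powr_realpow[symmetric] powr_powr del: power_Suc of_nat_Suc)
    moreover have "1 / (2 * real n) - 1 + (real n - 1) / real n * real (Suc j) = real (Suc j) - a j - 1"
      using n by (simp add: a_def field_simps)
    moreover have "- (1 / (2 * real n)) - 1 + 1 / real n * real (Suc j) = a j - 1"
      using n by (simp add: a_def field_simps)
    moreover have "p * q * (p' * q') = (p * p') * (q * q')" for p q p' q' :: real by simp
    ultimately show ?thesis unfolding trin_kernel_def by (simp only: powr_add[symmetric])
  qed
  have int: "set_integrable lborel {0<..<1} ?b"
    using integrable_Beta[OF a' a] by (rule set_integrable_subset) auto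
  have "set_integrable lborel {0<..<1} (\<lambda>t. trin_kernel n t * trin_weight n t ^ Suc j)
      \<longleftrightarrow> set_integrable lborel {0<..<1} ?b"
    by (rule set_integrable_cong) (use eq in auto)
  then show "set_integrable lborel {0<..<1} (\<lambda>t. trin_kernel n t * trin_weight n t ^ Suc j)" using int by simp
  have "(LBINT t:{0<..<1}. trin_kernel n t * trin_weight n t ^ Suc j) = (LBINT t:{0<..<1}. ?b t)"
    by (rule set_lebesgue_integral_cong) (use eq in auto)
  also have "\<dots> = integral {0<..<1} ?b" by (rule set_borel_integral_eq_integral(2)[OF int])
  also have "\<dots> = Beta (real (Suc j) - a j) (a j)"
    using has_integral_Beta_real[OF a' a] by (intro integral_unique) (simp add: has_integral_Icc_iff_Ioo)
  finally show "(LBINT t:{0<..<1}. trin_kernel n t * trin_weight n t ^ Suc j) = Beta (real (Suc j) - a j) (a j)" .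
qed

lemma log_integral_trin:
  assumes n: "n \<ge> 2" and e: "norm e = 1"
  shows "log_integral (trin_kernel n) (trin_weight n) e"
proof
  show "set_integrable lborel {0<..<1} (\<lambda>t. trin_kernel n t * trin_weight n t)"
    using trin_kernel_moments(1)[OF n, of 0] by simp
  show "continuous_on {0..1} (trin_weight n)" unfolding trin_weight_def [abs_def]
    using n by (intro continuous_intros continuous_on_powr') auto
  show "trin_weight n t \<in> {0..1}" if "t \<in> {0..1}" for t
    using that n by (auto simp: trin_weight_def intro!: mult_le_one powr_le1)
  show "trin_kernel n \<in> borel_measurable borel" "trin_weight n \<in> borel_measurable borel"
    unfolding trin_kernel_def [abs_def] trin_weight_def [abs_def] by measurable
qed (use e in \<open>auto simp: trin_kernel_def trin_weight_def\<close>)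

section \<open>The integral representation\<close>

theorem mainTheorem1:
  fixes n :: nat
  assumes "n \<ge> 2"
  shows "(\<exists>z. principal_root n z) \<and>
    (\<forall>x\<in>trin_domain n. set_integrable lborel {0<..<1} (trin_integrand n x)) \<and>
    (\<forall>z. principal_root n z \<longrightarrow>
      (\<forall>x\<in>trin_domain n.
         z x ^ n + x * z x ^ (n - 1) - 1 = 0 \<and>
         z x = (1 + 1 / (4 * of_real pi * \<i> * of_nat n) *
                    (LBINT t:{0<..<1}. trin_integrand n x t))\<^sup>2))"
proof -

  \<comment> \<open>The domain as an intersection of two star-shaped open sets\<close>
  have n1: "n \<ge> 1" using assms by simp
  define em where "em = exp (- (of_real pi * \<i> / of_nat n))"
  define ep where "ep = exp (of_real pi * \<i> / of_nat n)"
  define cp where "cp = exp (of_real pi * \<i> / (2 * of_nat n))"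
  define cm where "cm = exp (- (of_real pi * \<i> / (2 * of_nat n)))"
  interpret m: log_integral "trin_kernel n" "trin_weight n" em
    by (rule log_integral_trin[OF assms]) (simp add: em_def norm_exp_eq_Re)
  interpret p: log_integral "trin_kernel n" "trin_weight n" ep
    by (rule log_integral_trin[OF assms]) (simp add: ep_def norm_exp_eq_Re)
  let ?D = "trin_domain n"
  \<comment> \<open>\<open>Sigma_minus\<close> and \<open>Sigma_plus\<close> are the complements of
    the logarithm domains for \<open>em\<close> and \<open>ep\<close>.\<close>
  have D: "?D = m.log_domain \<inter> p.log_domain"
    unfolding trin_domain_def Sigma_minus_def Sigma_plus_def m.log_domain_def p.log_domain_def
    unfolding em_def ep_def by auto
  have openD: "open ?D" unfolding D using m.open_log_domain p.open_log_domain by blast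
  have D0: "0 \<in> ?D" unfolding D using m.zero_in_log_domain p.zero_in_log_domain by blast
  have "starlike ?D" unfolding starlike_def
  proof (intro bexI[OF _ D0] ballI subsetI)
    fix x y assume x: "x \<in> ?D" and y: "y \<in> closed_segment 0 x"
    then obtain s where s: "s \<in> {0..1}" "y = of_real s * x"
      by (auto simp: closed_segment_def scaleR_conv_of_real)
    show "y \<in> ?D" unfolding s(2) using x s(1) m.scale_in_log_domain p.scale_in_log_domain
      unfolding D by blast
  qed
  then have connD: "connected ?D" by (rule starlike_imp_connected)

  \<comment> \<open>Convergence and holomorphy of the bracketed expression\<close>
  have integrand: "trin_integrand n x = (\<lambda>t.
      cp * (of_real (trin_kernel n t) * Ln (1 + x * of_real (trin_weight n t) * em)) -
      cm * (of_real (trin_kernel n t) * Ln (1 + x * of_real (trin_weight n t) * ep)))" for x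
    by (simp add: trin_integrand_def trin_kernel_def cp_def cm_def em_def ep_def fun_eq_iff algebra_simps)
  have int: "set_integrable lborel {0<..<1} (\<lambda>t. cp * (of_real (trin_kernel n t) * Ln (1 + x * of_real (trin_weight n t) * em)))"
    "set_integrable lborel {0<..<1} (\<lambda>t. cm * (of_real (trin_kernel n t) * Ln (1 + x * of_real (trin_weight n t) * ep)))"
    if "x \<in> ?D" for x
    using m.Ln_set_integrable[of x] p.Ln_set_integrable[of x] that unfolding D by auto
  have integrable: "set_integrable lborel {0<..<1} (trin_integrand n x)" if "x \<in> ?D" for x
    unfolding integrand using int[OF that] by (rule set_integral_diff)
  define F where "F = (\<lambda>x. 1 + 1 / (4 * of_real pi * \<i> * of_nat n) * (LBINT t:{0<..<1}. trin_integrand n x t))"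
  have FJ: "F x = 1 + 1 / (4 * of_real pi * \<i> * of_nat n) * (cp * m.J x - cm * p.J x)" if "x \<in> ?D" for x
    unfolding F_def integrand set_integral_diff(2)[OF int[OF that]] by (simp add: m.J_def p.J_def)
  have holF: "F holomorphic_on ?D"
  proof (rule holomorphic_transform)
    show "(\<lambda>x. 1 + 1 / (4 * of_real pi * \<i> * of_nat n) * (cp * m.J x - cm * p.J x)) holomorphic_on ?D"
      using m.J_holomorphic p.J_holomorphic unfolding D
      by (intro holomorphic_intros) (auto intro: holomorphic_on_subset)
  qed (simp add: FJ)
  have F0: "F 0 = 1" using FJ[OF D0] by (simp add: m.J_0 p.J_0)

  \<comment> \<open>Comparison of Taylor coefficients at the origin\<close>
  obtain g \<rho> where g: "\<rho> > 0" "g holomorphic_on ball 0 \<rho>" "g 0 = 1"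
    "\<And>x. x \<in> ball 0 \<rho> \<Longrightarrow> ((g x)\<^sup>2) ^ n + x * ((g x)\<^sup>2) ^ (n - 1) - 1 = 0"
    "\<And>k. (deriv ^^ Suc k) g 0 = (-1) ^ Suc k / (2 * of_nat n) *
        (fact k * ((of_nat k - (2 * of_nat k + 1) / (2 * of_nat n)) gchoose k))"
    using trinomial_sqrt_branch[OF n1] by metis
  define M where "M = (\<lambda>j. LBINT t:{0<..<1}. trin_kernel n t * trin_weight n t ^ Suc j)"
  have coeff: "1 / (4 * of_real pi * \<i> * of_nat n) *
      (cp * ((-1) ^ j / of_nat (Suc j) * of_real (M j) * em ^ Suc j) -
       cm * ((-1) ^ j / of_nat (Suc j) * of_real (M j) * ep ^ Suc j)) =
      (deriv ^^ Suc j) g 0 / fact (Suc j)" for j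
  proof -
    define a where "a = (2 * real j + 1) / (2 * real n)"
    \<comment> \<open>The phases combine as \<open>1 / (2n) - (j + 1) / n = - a\<close>, and
      oppositely in \<open>2\<close>, so their difference is a sine, ready for
      \<open>sin_times_Beta\<close>.\<close>
    have 1: "cp * em ^ Suc j = exp (- (\<i> * of_real (pi * a)))"
      unfolding cp_def em_def exp_of_nat_mult[symmetric] exp_add[symmetric] using n1
      by (intro arg_cong[of _ _ exp]) (simp add: a_def field_simps)
    have 2: "cm * ep ^ Suc j = exp (\<i> * of_real (pi * a))"
      unfolding cm_def ep_def exp_of_nat_mult[symmetric] exp_add[symmetric] using n1
      by (intro arg_cong[of _ _ exp]) (simp add: a_def field_simps)
    have "exp (\<i> * of_real (pi * a)) - exp (- (\<i> * of_real (pi * a))) = 2 * \<i> * sin (of_real (pi * a))"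
      by (simp add: sin_exp_eq)
    then have 3: "cp * em ^ Suc j - cm * ep ^ Suc j = - (2 * \<i> * sin (of_real (pi * a)))"
      unfolding 1 2 by (simp add: algebra_simps)
    have "M j = Beta (real (Suc j) - a) a" unfolding M_def a_def by (rule trin_kernel_moments(2)[OF assms])
    then have 4: "sin (of_real (pi * a)) * of_real (M j) =
        of_real pi * ((of_nat j - (2 * of_nat j + 1) / (2 * of_nat n) :: complex) gchoose j)"
      using sin_times_Beta[of a j] odd_over_even_notin_nonpos_Ints[OF n1, of j] n1 by (simp add: a_def)
    have "1 / (4 * of_real pi * \<i> * of_nat n) *
      (cp * ((-1) ^ j / of_nat (Suc j) * of_real (M j) * em ^ Suc j) -
       cm * ((-1) ^ j / of_nat (Suc j) * of_real (M j) * ep ^ Suc j)) =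
      1 / (4 * of_real pi * \<i> * of_nat n) * ((-1) ^ j / of_nat (Suc j) * of_real (M j) *
        (cp * em ^ Suc j - cm * ep ^ Suc j))" by (simp add: algebra_simps del: power_Suc of_nat_Suc)
    also have "\<dots> = - (1 / (2 * of_real pi * of_nat n)) * ((-1) ^ j / of_nat (Suc j)) *
        (sin (of_real (pi * a)) * of_real (M j))"
      unfolding 3 by (simp add: field_simps del: of_nat_Suc)
    also have "\<dots> = (deriv ^^ Suc j) g 0 / fact (Suc j)"
      unfolding 4 g(5) using n1 by (simp add: field_simps del: of_nat_Suc)
    finally show ?thesis .
  qed
  \<comment> \<open>The bound \<open>\<rho>\<close> serves the series of \<open>g\<close>, the bound
    1 that of the logarithms. Both constant terms are 1, so only the indices \<open>Suc j\<close>
    are compared.\<close>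
  have Fg: "F x = g x" if x: "x \<in> ?D" "norm x < \<rho>" "norm x < 1" for x
  proof -
    have "(\<lambda>k. (deriv ^^ k) g 0 / fact k * (x - 0) ^ k) sums g x"
      by (rule holomorphic_power_series[OF g(2)]) (use x in auto)
    then have 1: "(\<lambda>k. (deriv ^^ Suc k) g 0 / fact (Suc k) * x ^ Suc k) sums (g x - 1)"
      by (subst sums_Suc_iff) (simp add: g(3))
    have "(\<lambda>j. 1 / (4 * of_real pi * \<i> * of_nat n) *
       (cp * ((-1) ^ j / of_nat (Suc j) * of_real (M j) * em ^ Suc j * x ^ Suc j) -
        cm * ((-1) ^ j / of_nat (Suc j) * of_real (M j) * ep ^ Suc j * x ^ Suc j)))
      sums (1 / (4 * of_real pi * \<i> * of_nat n) * (cp * m.J x - cm * p.J x))"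
      unfolding M_def by (intro sums_mult sums_diff m.J_sums p.J_sums x)
    also have "(\<lambda>j. 1 / (4 * of_real pi * \<i> * of_nat n) *
       (cp * ((-1) ^ j / of_nat (Suc j) * of_real (M j) * em ^ Suc j * x ^ Suc j) -
        cm * ((-1) ^ j / of_nat (Suc j) * of_real (M j) * ep ^ Suc j * x ^ Suc j))) =
      (\<lambda>k. (deriv ^^ Suc k) g 0 / fact (Suc k) * x ^ Suc k)"
      unfolding coeff[symmetric] mult.assoc[symmetric] left_diff_distrib[symmetric] ..
    finally have "1 / (4 * of_real pi * \<i> * of_nat n) * (cp * m.J x - cm * p.J x) = g x - 1"
      using 1 sums_unique2 by blast
    then show ?thesis by (simp add: FJ[OF x(1)])
  qed
  have evF: "\<forall>\<^sub>F x in nhds 0. ((F x)\<^sup>2) ^ n + x * ((F x)\<^sup>2) ^ (n - 1) - 1 = 0"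
  proof -
    have "\<forall>\<^sub>F x in nhds 0. x \<in> ?D \<inter> ball 0 \<rho> \<inter> ball 0 1"
      using openD D0 g(1) by (intro eventually_nhds_in_open) auto
    then show ?thesis by eventually_elim (use g(4) Fg in auto)
  qed

  \<comment> \<open>Continuation from the origin to the whole domain\<close>
  have holF2: "(\<lambda>x. (F x)\<^sup>2) holomorphic_on ?D" using holF by (intro holomorphic_intros)
  have prF: "principal_root n (\<lambda>x. (F x)\<^sup>2)"
    unfolding principal_root_def using holF2 F0 evF by simp
  have cont: "isCont f 0" if "f holomorphic_on ?D" for f :: "complex \<Rightarrow> complex"
    using that openD D0 holomorphic_on_imp_continuous_on continuous_on_eq_continuous_at by blast
  have eqD: "f x = h x" if fh: "f holomorphic_on ?D" "h holomorphic_on ?D" "\<forall>\<^sub>F x in nhds 0. f x = h x" "x \<in> ?D"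
    for f h :: "complex \<Rightarrow> complex" and x
  proof -
    obtain S where S: "open S" "0 \<in> S" "\<And>x. x \<in> S \<Longrightarrow> f x = h x"
      using fh(3) unfolding eventually_nhds by blast
    show ?thesis
      by (rule analytic_continuation_open[of "S \<inter> ?D" ?D f h]) (use S openD D0 connD fh in auto)
  qed
  have "z x ^ n + x * z x ^ (n - 1) - 1 = 0 \<and> z x = (F x)\<^sup>2"
    if z: "principal_root n z" and x: "x \<in> ?D" for z x
  proof
    have hz: "z holomorphic_on ?D" "z 0 = 1" "\<forall>\<^sub>F x in nhds 0. z x ^ n + x * z x ^ (n - 1) - 1 = 0"
      using z by (auto simp: principal_root_def)
    \<comment> \<open>The left side of the equation is holomorphic and vanishes near 0, so the
      identity theorem makes it vanish throughout the domain.\<close>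
    show "z x ^ n + x * z x ^ (n - 1) - 1 = 0"
      by (rule eqD[of "\<lambda>x. z x ^ n + x * z x ^ (n - 1) - 1" "\<lambda>_. 0"])
        (use hz x in \<open>auto intro!: holomorphic_intros\<close>)
    show "z x = (F x)\<^sup>2"
    \<comment> \<open>Local uniqueness gives agreement near 0, and the identity theorem propagates
      it.\<close>
    proof (rule eqD[OF hz(1) holF2 _ x])
      show "\<forall>\<^sub>F x in nhds 0. z x = (F x)\<^sup>2"
        by (rule trinomial_root_locally_unique[OF n1])
          (use cont hz holF2 F0 evF in auto)
    qed
  qed
  with prF integrable show ?thesis unfolding F_def by blast
qed

end
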